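(* Let $[\lambda(j)]=[\lambda(1),\ldots,\lambda(r)]$ be an $r$-multipartition of $n$, and let $\tilde\lambda$ be the partition of $n$ with parts $\tilde\lambda_i=\sum_{j=1}^r\lambda(j)_i$. The only partition $\mu$ of $n$ satisfying $K_{[\lambda(j)]\mu}=1$ is $\mu=\tilde\lambda$ if and only if for each $i\ge1$ either (1) $\tilde\lambda_i-\tilde\lambda_{i+1}\le1$, or (2) there exist at least two $j$ such that $\lambda(j)_i-\lambda(j)_{i+1}\ge1$ (where $\tilde\lambda_i=0$ if $i>\ell(\tilde\lambda)$ and $\lambda(j)_i=0$ if $i>\ell(\lambda(j))$).
   Context: $\ell(\lambda)$ is the number of (positive) parts of a partition $\lambda$. An $r$-multipartition of $n$ is a sequence $[\lambda(j)]=[\lambda(1),\ldots,\lambda(r)]$ of (possibly empty) partitions with $\sum_j|\lambda(j)|=n$. A semistandard Young tableau of shape $\lambda$ is a filling of the Young diagram of $\lambda$ by positive integers, weakly increasing along rows and strictly increasing down columns; its weight is the sequence whose $i$-th entry is the number of times $i$ occurs. A semistandard Young $r$-multitableau of shape $[\lambda(j)]$ and weight $\mu$ is a sequence $[T(1),\ldots,T(r)]$ of semistandard Young tableaux, $T(j)$ of shape $\lambda(j)$ and weight $\omega(j)$, with $\mu_i=\sum_{j=1}^r\omega(j)_i$ for all $i$. $K_{[\lambda(j)]\mu}$ is the number of these. *)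

theory Defs
  imports Main
begin

text \<open>A partition is the list of its positive parts in weakly decreasing order;
  in particular \<open>\<ell>(\<lambda>)\<close> is \<open>length lam\<close>.\<close>

definition is_partition_of :: "nat \<Rightarrow> nat list \<Rightarrow> bool" where
  "is_partition_of n lam \<longleftrightarrow> sorted_wrt (\<ge>) lam \<and> (\<forall>p\<in>set lam. 0 < p) \<and> sum_list lam = n"

text \<open>\<open>part lam i\<close> is \<open>\<lambda>\<^sub>i\<close>, where parts are counted from \<open>i = 1\<close> and
  \<open>\<lambda>\<^sub>i = 0\<close> for \<open>i > \<ell>(\<lambda>)\<close>.  The index \<open>i = 0\<close> carries no meaning.\<close>

definition part :: "nat list \<Rightarrow> nat \<Rightarrow> nat" where
  "part lam i = (if 1 \<le> i \<and> i \<le> length lam then lam ! (i - 1) else 0)"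

text \<open>The component \<open>\<lambda>(j)\<close> of a multipartition, \<open>1 \<le> j \<le> r\<close>, is the list entry \<open>L ! (j - 1)\<close>.\<close>

definition is_multipartition_of :: "nat \<Rightarrow> nat \<Rightarrow> nat list list \<Rightarrow> bool" where
  "is_multipartition_of r n L \<longleftrightarrow>
     length L = r \<and> (\<forall>lam\<in>set L. is_partition_of (sum_list lam) lam) \<and>
     (\<Sum>lam\<leftarrow>L. sum_list lam) = n"

text \<open>A tableau is the list of its rows, top row first (English convention).\<close>

definition semistandard :: "nat list \<Rightarrow> nat list list \<Rightarrow> bool" where
  "semistandard lam T \<longleftrightarrow>
     map length T = lam \<and>
     (\<forall>row\<in>set T. \<forall>x\<in>set row. 1 \<le> x) \<and>
     (\<forall>row\<in>set T. sorted row) \<and>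
     (\<forall>i j. Suc i < length T \<and> j < length (T ! Suc i) \<longrightarrow> T ! i ! j < T ! Suc i ! j)"

definition weight :: "nat list list \<Rightarrow> nat \<Rightarrow> nat" where
  "weight T i = count_list (concat T) i"

definition multitableaux :: "nat list list \<Rightarrow> nat list \<Rightarrow> nat list list list set" where
  "multitableaux L mu =
     {Ts. list_all2 semistandard L Ts \<and> (\<forall>i\<ge>1. part mu i = (\<Sum>T\<leftarrow>Ts. weight T i))}"

definition multikostka :: "nat list list \<Rightarrow> nat list \<Rightarrow> nat" where
  "multikostka L mu = card (multitableaux L mu)"

text \<open>The partition \<open>\<lambda>~\<close>, listed up to the largest length of a component (no later part
  is positive); \<open>part_lam_tilde\<close> and \<open>is_partition_of_lam_tilde\<close> below confirm that this list
  is the intended partition.\<close>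

definition lam_tilde :: "nat list list \<Rightarrow> nat list" where
  "lam_tilde L = map (\<lambda>i. \<Sum>lam\<leftarrow>L. part lam i) [1..<Suc (Max (insert 0 (length ` set L)))]"

lemma part_lam_tilde:
  assumes "1 \<le> i"
  shows "part (lam_tilde L) i = (\<Sum>lam\<leftarrow>L. part lam i)"
proof -
  have len_tilde: "length (lam_tilde L) = Max (insert 0 (length ` set L))"
    by (simp add: lam_tilde_def del: upt_Suc)
  show ?thesis
  proof (cases "i \<le> Max (insert 0 (length ` set L))")
    case True
    then have "part (lam_tilde L) i = lam_tilde L ! (i - 1)"
      using assms by (simp add: part_def[of "lam_tilde L"] len_tilde)
    with True assms show ?thesis
      by (simp add: lam_tilde_def del: upt_Suc)
  next
    case False
    have "part lam i = 0" if "lam \<in> set L" for lam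
    proof -
      have "length lam \<le> Max (insert 0 (length ` set L))"
        using that by (intro Max_ge) auto
      with False show ?thesis by (simp add: part_def)
    qed
    then have "(\<Sum>lam\<leftarrow>L. part lam i) = 0"
      by (auto simp: sum_list_eq_0_iff)
    moreover have "part (lam_tilde L) i = 0"
      using False by (simp add: part_def[of "lam_tilde L"] len_tilde)
    ultimately show ?thesis by simp
  qed
qed

lemma sum_list_eq_sum_part:
  assumes "length lam \<le> m"
  shows "sum_list lam = (\<Sum>i\<in>{1..<Suc m}. part lam i)"
proof -
  have "(\<Sum>i\<in>{1..<Suc m}. part lam i) = (\<Sum>i\<in>{1..<Suc (length lam)}. part lam i)"
    using assms by (intro sum.mono_neutral_right) (auto simp: part_def)
  also have "\<dots> = (\<Sum>i\<in>{0..<length lam}. part lam (Suc i))"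
    using sum.shift_bounds_Suc_ivl[of "part lam" 0 "length lam"] by simp
  also have "\<dots> = sum_list lam"
    by (simp add: part_def sum_list_sum_nth)
  finally show ?thesis by simp
qed

lemma is_partition_of_lam_tilde:
  assumes "is_multipartition_of r n L"
  shows "is_partition_of n (lam_tilde L)"
proof -
  define m where "m = Max (insert 0 (length ` set L))"
  have len: "length lam \<le> m" if "lam \<in> set L" for lam
    using that by (auto simp: m_def)
  have P: "is_partition_of (sum_list lam) lam" if "lam \<in> set L" for lam
    using assms that by (auto simp: is_multipartition_of_def)
  have lt: "lam_tilde L = map (\<lambda>i. \<Sum>lam\<leftarrow>L. part lam i) [1..<Suc m]"
    by (simp add: lam_tilde_def m_def)
  have anti: "part lam b \<le> part lam a" if "lam \<in> set L" "1 \<le> a" "a < b" for lam a b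
    using P[OF that(1)] that(2,3)
    by (auto simp: part_def is_partition_of_def sorted_wrt_iff_nth_less)
  have "sorted_wrt (\<ge>) (lam_tilde L)"
    unfolding lt sorted_wrt_map
    by (rule sorted_wrt_mono_rel[OF _ sorted_wrt_upt])
      (auto intro!: sum_list_mono anti)
  moreover have "0 < (\<Sum>lam\<leftarrow>L. part lam i)" if "1 \<le> i" "i \<le> m" for i
  proof -
    have "m \<in> insert 0 (length ` set L)"
      unfolding m_def by (rule Max_in) auto
    with that obtain lam where lam: "lam \<in> set L" "length lam = m" by auto
    then have "0 < part lam i"
      using P[OF lam(1)] that by (auto simp: part_def is_partition_of_def)
    then show ?thesis
      using lam(1) member_le_sum_list[of "part lam i" "map (\<lambda>lam. part lam i) L"]
      by fastforce
  qed
  then have "\<forall>p\<in>set (lam_tilde L). 0 < p"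
    unfolding lt by auto
  moreover have "sum_list (lam_tilde L) = n"
  proof -
    have "n = (\<Sum>lam\<leftarrow>L. \<Sum>i\<in>{1..<Suc m}. part lam i)"
      using assms len sum_list_eq_sum_part
      by (auto simp: is_multipartition_of_def intro!: arg_cong[of _ _ sum_list] map_cong)
    also have "\<dots> = (\<Sum>i\<in>{1..<Suc m}. \<Sum>lam\<leftarrow>L. part lam i)"
      by (induction L) (simp_all add: sum.distrib)
    also have "\<dots> = sum_list (lam_tilde L)"
      unfolding lt by (simp add: interv_sum_list_conv_sum_set_nat del: upt_Suc)
    finally show ?thesis by simp
  qed
  ultimately show ?thesis
    by (simp add: is_partition_of_def)
qed

end

theory Submission
  imports Defs
begin

text \<open>Counting the entries \<open>\<le> m\<close> in each row turns multitableaux of weight \<open>\<mu>\<close> into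
  Gelfand--Tsetlin patterns whose level sums are the partial sums \<open>\<mu>\<^sub>1 + \<dots> + \<mu>\<^sub>m\<close>. If the level
  sums \<open>B\<close> are strictly concave at \<open>m\<close>, then lowering \<open>B m\<close> by one preserves the existence of two
  patterns. Let \<open>C\<close> be the level sums of a partition \<open>\<mu> \<noteq> \<lambda>~\<close> with \<open>K > 0\<close>; then \<open>C \<le> B\<close> for the
  level sums \<open>B\<close> of \<open>\<lambda>~\<close>. Where \<open>B - C\<close> first reaches its maximum, \<open>B\<close> is strictly concave, so \<open>B\<close>
  can be lowered to \<open>C\<close> in such unit steps. Two patterns appear on the way: if \<open>\<lambda>~\<close> drops by at least
  2 at the first maximum of \<open>B - C\<close>, condition (2) gives two components with a removable cell
  there; if it drops by 1, then \<open>B - C\<close> has a plateau from \<open>m\<close> to some \<open>q > m\<close>, and there are two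
  ways to move one unit from row \<open>m\<close> to row \<open>q + 1\<close>. If the condition fails at \<open>i\<close>,
  the partition obtained from \<open>\<lambda>~\<close> by moving one unit from part \<open>i\<close> to part \<open>i + 1\<close> has \<open>K = 1\<close>.\<close>

section \<open>Gelfand--Tsetlin patterns\<close>

locale multishape =
  fixes r N :: nat and lam :: "nat \<times> nat \<Rightarrow> nat"
  assumes lam_outside: "x \<notin> {..<r} \<times> {..<N} \<Longrightarrow> lam x = 0"
    and lam_Suc_le: "lam (j, Suc i) \<le> lam (j, i)"
begin

abbreviation cells :: "(nat \<times> nat) set" where
  "cells \<equiv> {..<r} \<times> {..<N}"

text \<open>\<open>P m (j, i)\<close> stands for the number of entries \<open>\<le> m\<close> in row \<open>i\<close> of the \<open>j\<close>-th tableau, rows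
  and components being counted from 0; the second condition is column strictness. No top level is
  prescribed: \<open>P m = lam\<close> is forced as soon as \<open>B m\<close> is the number of cells.\<close>

definition patterns :: "(nat \<Rightarrow> nat) \<Rightarrow> (nat \<Rightarrow> nat \<times> nat \<Rightarrow> nat) set" where
  "patterns B = {P. (\<forall>m x. P m x \<le> P (Suc m) x) \<and>
     (\<forall>m j i. P (Suc m) (j, Suc i) \<le> P m (j, i)) \<and>
     (\<forall>m x. P m x \<le> lam x) \<and> (\<forall>m. sum (P m) cells = B m)}"

text \<open>Two distinct members instead of a bound on \<open>card\<close>, since
  \<open>card\<close> of an infinite set is 0.\<close>

definition multiple :: "(nat \<Rightarrow> nat) \<Rightarrow> bool" where
  "multiple B \<longleftrightarrow> (\<exists>P\<in>patterns B. \<exists>Q\<in>patterns B. P \<noteq> Q)"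

section \<open>The canonical pattern and its maximality\<close>

definition top_pattern :: "nat \<Rightarrow> nat \<times> nat \<Rightarrow> nat" where
  "top_pattern m x = (if snd x < m then lam x else 0)"

definition top_sum :: "nat \<Rightarrow> nat" where
  "top_sum m = sum (top_pattern m) cells"

lemma patternsD:
  assumes "P \<in> patterns B"
  shows "P m x \<le> P (Suc m) x" "P (Suc m) (j, Suc i) \<le> P m (j, i)" "P m x \<le> lam x"
    "sum (P m) cells = B m"
  using assms unfolding patterns_def by blast+

lemma finite_cells: "finite cells" by simp

text \<open>A strict inequality at one cell would make the sums differ; off \<open>cells\<close> the
  bound by \<open>lam\<close> forces both values to be 0. Through this lemma an extremal level sum
  determines its level.\<close>

lemma eq_if_le_sum_eq:
  fixes f g :: "nat \<times> nat \<Rightarrow> nat"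
  assumes le: "\<And>x. f x \<le> g x" "\<And>x. g x \<le> lam x" and s: "sum f cells = sum g cells"
  shows "f = g"
proof
  fix x
  show "f x = g x"
  proof (cases "x \<in> cells")
    case True
    show ?thesis
    proof (rule ccontr)
      assume "f x \<noteq> g x"
      then have "f x < g x" using le(1)[of x] by simp
      then have "sum f cells < sum g cells"
        using True le(1) by (intro sum_strict_mono_ex1) auto
      then show False using s by simp
    qed
  next
    case False
    then show ?thesis using le[of x] lam_outside[of x] by simp
  qed
qed

text \<open>Level 0 is zero, and the column condition moves zeros one row down per level: at level
  \<open>m\<close> every row \<open>i\<close> with \<open>m \<le> i\<close> is empty. The remaining
  rows are bounded by \<open>lam\<close>.\<close>

lemma pattern_le_top:
  assumes P: "P \<in> patterns B" and "B 0 = 0"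
  shows "P m x \<le> top_pattern m x"
proof -
  have P0: "P 0 x = 0" for x
  proof -
    have "P 0 = (\<lambda>x. 0)"
      using patternsD[OF P] assms(2) by (intro eq_if_le_sum_eq[symmetric]) simp_all
    then show ?thesis by simp
  qed
  have "P m (j, i) = 0" if "m \<le> i" for j i
    using that
  proof (induction m arbitrary: i)
    case (Suc m)
    then obtain i' where "i = Suc i'" "m \<le> i'" by (cases i) auto
    with Suc.IH[of i'] show ?case using patternsD(2)[OF P, of m j i'] by simp
  qed (simp add: P0)
  then show ?thesis
    using patternsD(3)[OF P, of m x] by (cases x) (auto simp: top_pattern_def)
qed

lemma top_pattern_le: "top_pattern m x \<le> lam x"
  by (simp add: top_pattern_def)

lemma top_sum_0: "top_sum 0 = 0"
  by (simp add: top_sum_def top_pattern_def)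

lemma top_pattern_mem: "top_pattern \<in> patterns top_sum"
  using lam_Suc_le by (auto simp: patterns_def top_sum_def top_pattern_def)

lemma pattern_sum_le:
  assumes "P \<in> patterns B" "B 0 = 0"
  shows "B m \<le> top_sum m"
  unfolding top_sum_def patternsD(4)[OF assms(1), of m, symmetric]
  by (intro sum_mono pattern_le_top[OF assms])

lemma pattern_level_eq_top:
  assumes P: "P \<in> patterns B" "B 0 = 0" and "B m = top_sum m"
  shows "P m = top_pattern m"
  using assms patternsD(4)[OF P(1), of m]
  by (intro eq_if_le_sum_eq pattern_le_top[OF P] top_pattern_le) (simp add: top_sum_def)

text \<open>Every level sum is extremal, so every level is forced.\<close>

lemma patterns_top_sum: "patterns top_sum = {top_pattern}"
proof -
  have "P = top_pattern" if "P \<in> patterns top_sum" for P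
    by (intro ext fun_cong[OF pattern_level_eq_top[where B = top_sum]]) (simp_all add: that top_sum_0)
  then show ?thesis using top_pattern_mem by blast
qed

lemma top_sum_Suc: "top_sum (Suc m) = top_sum m + (\<Sum>j<r. lam (j, m))"
proof -
  have "top_sum (Suc m) = (\<Sum>x\<in>cells. top_pattern m x + (if snd x = m then lam x else 0))"
    unfolding top_sum_def by (intro sum.cong) (auto simp: top_pattern_def)
  also have "\<dots> = top_sum m + (\<Sum>j<r. \<Sum>i<N. if i = m then lam (j, i) else 0)"
    unfolding sum.distrib top_sum_def sum.cartesian_product by (auto simp: case_prod_unfold intro!: sum.cong)
  also have "(\<Sum>j<r. \<Sum>i<N. if i = m then lam (j, i) else 0) = (\<Sum>j<r. lam (j, m))"
    using lam_outside by (intro sum.cong) auto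
  finally show ?thesis .
qed

text \<open>\<open>c t\<close> is the row, if any, that has one entry \<open>\<le> t\<close> fewer than in the canonical filling,
  where the \<open>k\<close>-th row from the top, \<open>k \<ge> 1\<close>, consists of \<open>k\<close>'s only.\<close>

definition cut_pattern :: "(nat \<Rightarrow> (nat \<times> nat) option) \<Rightarrow> nat \<Rightarrow> nat \<times> nat \<Rightarrow> nat" where
  "cut_pattern c t x = top_pattern t x - (if c t = Some x then 1 else 0)"

text \<open>By \<open>corner\<close> a shortened row is still as long as the row below it in
  \<open>lam\<close>. By \<open>step\<close> the cut can pass to a new row only at the level where
  that row is first filled, so counts never decrease with the level.\<close>

lemma cut_pattern_mem:
  assumes corner: "\<And>t j i. c t = Some (j, i) \<Longrightarrow> i < t \<and> lam (j, Suc i) < lam (j, i)"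
    and step: "\<And>t j i. c (Suc t) = Some (j, i) \<Longrightarrow> c t = Some (j, i) \<or> i = t"
  shows "cut_pattern c \<in> patterns (\<lambda>t. top_sum t - (if c t = None then 0 else 1))"
  unfolding patterns_def
proof (intro CollectI conjI allI)
  fix m x
  show "cut_pattern c m x \<le> lam x"
    by (simp add: cut_pattern_def top_pattern_def)
  show "cut_pattern c m x \<le> cut_pattern c (Suc m) x"
    using step[of m "fst x" "snd x"] by (auto simp: cut_pattern_def top_pattern_def)
next
  fix m j i
  show "cut_pattern c (Suc m) (j, Suc i) \<le> cut_pattern c m (j, i)"
    using corner[of m j i] lam_Suc_le[of j i] by (auto simp: cut_pattern_def top_pattern_def)
next
  fix m
  show "sum (cut_pattern c m) cells = top_sum m - (if c m = None then 0 else 1)"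
  proof (cases "c m")
    case None
    then show ?thesis by (simp add: cut_pattern_def top_sum_def)
  next
    case (Some x)
    obtain j i where x: "x = (j, i)" by (cases x)
    have pos: "0 < top_pattern m x" and xc: "x \<in> cells"
      using corner[of m j i] Some lam_outside[of x] by (auto simp: x top_pattern_def)
    have "sum (cut_pattern c m) cells = (top_pattern m x - 1) + sum (top_pattern m) (cells - {x})"
      unfolding sum.remove[OF finite_cells xc]
      using Some by (intro arg_cong2[of _ _ _ _ "(+)"] sum.cong) (auto simp: cut_pattern_def)
    moreover have "top_sum m = top_pattern m x + sum (top_pattern m) (cells - {x})"
      unfolding top_sum_def by (rule sum.remove[OF finite_cells xc])
    ultimately show ?thesis using pos Some by simp
  qed
qed

text \<open>Cutting row \<open>a\<close> at level \<open>Suc a\<close> alone changes its last entry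
  from \<open>a + 1\<close> to \<open>a + 2\<close>; both components have a corner in which to do
  so.\<close>

lemma multiple_two_components:
  assumes "j \<noteq> j'" "lam (j, Suc a) < lam (j, a)" "lam (j', Suc a) < lam (j', a)"
  shows "multiple (\<lambda>t. top_sum t - (if t = Suc a then 1 else 0))"
proof -
  define c where "c k t = (if t = Suc a then Some (k, a) else None)" for k t :: nat
  have mem: "cut_pattern (c k) \<in> patterns (\<lambda>t. top_sum t - (if t = Suc a then 1 else 0))"
    if "lam (k, Suc a) < lam (k, a)" for k
  proof -
    have "cut_pattern (c k) \<in> patterns (\<lambda>t. top_sum t - (if c k t = None then 0 else 1))"
      using that by (intro cut_pattern_mem) (auto simp: c_def split: if_splits)
    also have "(\<lambda>t. top_sum t - (if c k t = None then 0 else 1)) =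
        (\<lambda>t. top_sum t - (if t = Suc a then 1 else 0))"
      by (auto simp: c_def)
    finally show ?thesis .
  qed
  have "cut_pattern (c j) (Suc a) (j, a) \<noteq> cut_pattern (c j') (Suc a) (j, a)"
    using assms by (auto simp: cut_pattern_def c_def top_pattern_def)
  then have "cut_pattern (c j) \<noteq> cut_pattern (c j')" by metis
  then show ?thesis using mem assms by (auto simp: multiple_def)
qed

text \<open>One unit travels either directly or in two stages. In \<open>c\<close> the last entry of
  row \<open>a\<close> becomes \<open>b + 2\<close>; in \<open>d\<close> it becomes
  \<open>b + 1\<close>, and the last entry of row \<open>b\<close> of component \<open>j'\<close>
  becomes \<open>b + 2\<close>.\<close>

lemma multiple_two_levels:
  assumes "a < b" "lam (j, Suc a) < lam (j, a)" "lam (j', Suc b) < lam (j', b)"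
  shows "multiple (\<lambda>t. top_sum t - (if Suc a \<le> t \<and> t \<le> Suc b then 1 else 0))"
    (is "multiple ?B")
proof -
  define c where "c t = (if Suc a \<le> t \<and> t \<le> Suc b then Some (j, a) else None)" for t
  define d where "d = c(Suc b := Some (j', b))"
  have "cut_pattern c \<in> patterns (\<lambda>t. top_sum t - (if c t = None then 0 else 1))"
    using assms by (intro cut_pattern_mem) (auto simp: c_def split: if_splits)
  also have "(\<lambda>t. top_sum t - (if c t = None then 0 else 1)) = ?B"
    by (auto simp: c_def)
  finally have c: "cut_pattern c \<in> patterns ?B" .
  have "cut_pattern d \<in> patterns (\<lambda>t. top_sum t - (if d t = None then 0 else 1))"
    using assms by (intro cut_pattern_mem) (auto simp: d_def c_def split: if_splits)
  also have "(\<lambda>t. top_sum t - (if d t = None then 0 else 1)) = ?B"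
    using assms(1) by (auto simp: c_def d_def)
  finally have d: "cut_pattern d \<in> patterns ?B" .
  have "cut_pattern c (Suc b) (j, a) \<noteq> cut_pattern d (Suc b) (j, a)"
    using assms by (auto simp: cut_pattern_def c_def d_def top_pattern_def)
  then have "cut_pattern c \<noteq> cut_pattern d" by metis
  then show ?thesis using c d by (auto simp: multiple_def)
qed

text \<open>All levels except \<open>Suc a\<close> are extremal, hence forced. At level
  \<open>Suc a\<close>, rows above \<open>a\<close> are full by level \<open>a\<close>, and row
  \<open>a\<close> of a component other than \<open>j\<close> is full because row
  \<open>Suc a\<close> has the same length and is full one level later. The level sum then fixes the
  value at \<open>(j, a)\<close>.\<close>

lemma card_patterns_one_cut:
  assumes drop: "lam (j, Suc a) < lam (j, a)"
    and uniq: "\<And>k. lam (k, Suc a) < lam (k, a) \<Longrightarrow> k = j"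
  shows "card (patterns (\<lambda>t. top_sum t - (if t = Suc a then 1 else 0))) = 1"
    (is "card (patterns ?B) = 1")
proof -
  define c where "c t = (if t = Suc a then Some (j, a) else None)" for t
  have "cut_pattern c \<in> patterns (\<lambda>t. top_sum t - (if c t = None then 0 else 1))"
    using drop by (intro cut_pattern_mem) (auto simp: c_def split: if_splits)
  also have "(\<lambda>t. top_sum t - (if c t = None then 0 else 1)) = ?B"
    by (auto simp: c_def)
  finally have c: "cut_pattern c \<in> patterns ?B" .
  have "P = cut_pattern c" if P: "P \<in> patterns ?B" for P
  proof -
    have B0: "?B 0 = 0" by (simp add: top_sum_0)
    have other: "P t = top_pattern t" if "t \<noteq> Suc a" for t
      using that by (intro pattern_level_eq_top[OF P B0]) simp
    have away: "P (Suc a) x = top_pattern (Suc a) x" if "x \<noteq> (j, a)" for x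
    proof -
      obtain k i where x: "x = (k, i)" by (cases x)
      have up: "P (Suc a) (k, i) \<le> top_pattern (Suc a) (k, i)"
        by (rule pattern_le_top[OF P B0])
      consider "a < i" | "i < a" | "i = a" by linarith
      then have "top_pattern (Suc a) (k, i) \<le> P (Suc a) (k, i)"
      proof cases
        case 2
        then show ?thesis
          using patternsD(1)[OF P, of a "(k, i)"] other[of a] by (simp add: top_pattern_def)
      next
        case 3
        then have "k \<noteq> j" using that x by auto
        then have "lam (k, a) \<le> lam (k, Suc a)" using uniq[of k] by fastforce
        then show ?thesis
          using patternsD(2)[OF P, of "Suc a" k a] other[of "Suc (Suc a)"] 3
          by (simp add: top_pattern_def)
      qed (simp add: top_pattern_def)
      then show ?thesis using up x by simp
    qed
    have mem: "(j, a) \<in> cells" using drop lam_outside[of "(j, a)"] by auto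
    have "sum (P (Suc a)) cells = sum (cut_pattern c (Suc a)) cells"
      using patternsD(4)[OF P, of "Suc a"] patternsD(4)[OF c, of "Suc a"] by simp
    moreover have "sum (P (Suc a)) (cells - {(j, a)}) = sum (cut_pattern c (Suc a)) (cells - {(j, a)})"
      by (intro sum.cong) (auto simp: away cut_pattern_def c_def)
    ultimately have "P (Suc a) (j, a) = cut_pattern c (Suc a) (j, a)"
      by (simp add: sum.remove[OF finite_cells mem])
    then have "P (Suc a) x = cut_pattern c (Suc a) x" for x
      using away[of x] by (cases "x = (j, a)") (auto simp: cut_pattern_def c_def)
    moreover have "P t x = cut_pattern c t x" if "t \<noteq> Suc a" for t x
      using that other by (simp add: cut_pattern_def c_def)
    ultimately show ?thesis by (intro ext) metis
  qed
  then have "patterns ?B = {cut_pattern c}" using c by blast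
  then show ?thesis by simp
qed

end

section \<open>Lowering a level sum\<close>

text \<open>The maximum and minimum of \<open>a (Suc i)\<close> and \<open>b i\<close> add up to
  \<open>a (Suc i) + b i\<close>; the term \<open>a 0\<close> has no partner.\<close>

lemma sum_interlacing_bounds:
  fixes a b :: "nat \<Rightarrow> nat"
  shows "(\<Sum>i<N. max (a (Suc i)) (b i)) +
      (\<Sum>i<Suc N. case i of 0 \<Rightarrow> a 0 | Suc k \<Rightarrow> min (a (Suc k)) (b k)) =
    (\<Sum>i<Suc N. a i) + (\<Sum>i<N. b i)"
  by (induction N) (simp_all add: max_def min_def)

lemma lower_one:
  fixes l x :: "'a \<Rightarrow> nat"
  assumes "finite X" "p \<in> X" "l p < x p" "\<And>z. l z \<le> x z" "\<And>z. x z \<le> u z"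
  shows "sum (x(p := x p - 1)) X + 1 = sum x X" "l z \<le> (x(p := x p - 1)) z"
    "(x(p := x p - 1)) z \<le> u z"
proof -
  have "sum (x(p := x p - 1)) X = (x p - 1) + sum x (X - {p})"
    using assms by (subst sum.remove[OF assms(1,2)]) auto
  then show "sum (x(p := x p - 1)) X + 1 = sum x X"
    using assms by (simp add: sum.remove[OF assms(1,2), of x])
qed (use assms(3) assms(4)[of z] assms(5)[of z] in auto)

lemma exists_above_lower_bound:
  fixes l x :: "'a \<Rightarrow> nat"
  assumes "sum l X < sum x X"
  obtains p where "p \<in> X" "l p < x p"
  using assms by (meson linorder_not_less sum_mono)

text \<open>Lower \<open>x\<close> and \<open>y\<close> by one unit each, at places above
  \<open>l\<close>. If the results coincide, there is still a place above \<open>l\<close> at which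
  one of \<open>x\<close>, \<open>y\<close> can be lowered differently.\<close>

lemma two_lowered:
  fixes l u x y :: "'a \<Rightarrow> nat"
  assumes X: "finite X" and bx: "\<And>z. l z \<le> x z" "\<And>z. x z \<le> u z"
    and bY: "\<And>z. l z \<le> y z" "\<And>z. y z \<le> u z"
    and ne: "x \<noteq> y" and off: "\<forall>z. z \<notin> X \<longrightarrow> x z = y z"
    and s: "sum x X = sum y X" and mid: "sum l X + sum u X < 2 * sum x X"
  shows "\<exists>g h. g \<noteq> h \<and> (\<forall>z. l z \<le> g z \<and> g z \<le> u z) \<and> (\<forall>z. l z \<le> h z \<and> h z \<le> u z) \<and>
    sum g X + 1 = sum x X \<and> sum h X + 1 = sum x X"
proof -
  have witness: ?thesis if "g \<noteq> h" "\<And>z. l z \<le> g z" "\<And>z. g z \<le> u z" "\<And>z. l z \<le> h z"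
    "\<And>z. h z \<le> u z" "sum g X + 1 = sum x X" "sum h X + 1 = sum x X" for g h
    using that by (intro exI[of _ g] exI[of _ h] conjI allI) auto
  obtain z where z: "z \<in> X" "x z \<noteq> y z" using ne off by blast
  have "sum x X < sum u X"
  proof (rule ccontr)
    assume "\<not> sum x X < sum u X"
    then have "sum u X = sum x X" "sum u X = sum y X"
      using sum_mono[of X x u] bx(2) s by force+
    moreover have "sum x X < sum u X \<or> sum y X < sum u X"
    proof (cases "x z < y z")
      case True
      then have "x z < u z" using bY(2)[of z] by simp
      then show ?thesis using X z bx by (intro disjI1 sum_strict_mono_ex1) auto
    next
      case False
      then have "y z < u z" using bx(2)[of z] z by simp
      then show ?thesis using X z bY by (intro disjI2 sum_strict_mono_ex1) auto
    qed
    ultimately show False by simp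
  qed
  \<comment> \<open>Since \<open>x\<close> and \<open>y\<close> cannot both equal \<open>u\<close>
    on \<open>X\<close>, their common sum is below that of \<open>u\<close>; being above the middle,
    it exceeds the sum of \<open>l\<close> by at least 2.\<close>
  with mid have two: "sum l X + 2 \<le> sum x X" by linarith
  obtain p where p: "p \<in> X" "l p < x p" using two by (elim exists_above_lower_bound[of l X x, rotated]) auto
  obtain q where q: "q \<in> X" "l q < y q" using two s by (elim exists_above_lower_bound[of l X y, rotated]) auto
  note xp = lower_one[where l = l and u = u, OF X p bx] and yq = lower_one[where l = l and u = u, OF X q bY]
  show ?thesis
  proof (cases "x(p := x p - 1) = y(q := y q - 1)")
    case False
    show ?thesis
      by (rule witness[OF False xp(2,3) yq(2,3) xp(1)]) (use yq(1) s in simp)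
  next
    case True
    define w where "w = x(p := x p - 1)"
    have w: "w = x(p := x p - 1)" "w = y(q := y q - 1)" using True by (auto simp: w_def)
    have "p \<noteq> q"
    proof
      assume "p = q"
      have "x t = y t" for t
        using fun_cong[OF True, of t] p q \<open>p = q\<close> by (cases "t = p") auto
      then show False using ne by blast
    qed
    \<comment> \<open>The common point \<open>w\<close> keeps one of the two units of room. The
      place \<open>t\<close> found there is also above \<open>l\<close> in \<open>x\<close> and in
      \<open>y\<close>, and since \<open>p \<noteq> q\<close> it differs from \<open>p\<close> or
      from \<open>q\<close>.\<close>
    have "sum l X < sum w X" using two xp(1) w by simp
    then obtain t where t: "t \<in> X" "l t < w t" by (rule exists_above_lower_bound)
    have tx: "l t < x t" and ty: "l t < y t"
      using t(2) fun_cong[OF w(1), of t] fun_cong[OF w(2), of t] by (auto split: if_splits)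
    show ?thesis
    proof (cases "t = p")
      case True
      note yt = lower_one[where l = l and u = u, OF X t(1) ty bY]
      have ne: "y(q := y q - 1) \<noteq> y(t := y t - 1)"
        using True \<open>p \<noteq> q\<close> q by (auto simp: fun_eq_iff)
      show ?thesis
        by (rule witness[OF ne yq(2,3) yt(2,3)]) (use yq(1) yt(1) s in simp_all)
    next
      case False
      note xt = lower_one[where l = l and u = u, OF X t(1) tx bx]
      have ne: "x(p := x p - 1) \<noteq> x(t := x t - 1)"
        using False p by (auto simp: fun_eq_iff)
      show ?thesis
        by (rule witness[OF ne xp(2,3) xt(2,3) xp(1) xt(1)])
    qed
  qed
qed


context multishape
begin

lemma pattern_update:
  assumes P: "P \<in> patterns B"
    and l: "\<And>j i. max (P (Suc (Suc k)) (j, Suc i)) (P k (j, i)) \<le> g (j, i)"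
    and u0: "\<And>j. g (j, 0) \<le> P (Suc (Suc k)) (j, 0)"
    and u: "\<And>j i. g (j, Suc i) \<le> min (P (Suc (Suc k)) (j, Suc i)) (P k (j, i))"
    and s: "sum g cells + 1 = B (Suc k)"
  shows "P(Suc k := g) \<in> patterns (B(Suc k := B (Suc k) - 1))"
proof -
  have up: "g (j, i) \<le> P (Suc (Suc k)) (j, i)" for j i
    using u0 u by (cases i) auto
  show ?thesis
    unfolding patterns_def
  proof (intro CollectI conjI allI)
    fix m and x :: "nat \<times> nat"
    obtain j i where x: "x = (j, i)" by (cases x)
    show "(P(Suc k := g)) m x \<le> (P(Suc k := g)) (Suc m) x"
      using patternsD(1)[OF P, of m x] l[of j i] up[of j i] by (auto simp: x)
    show "(P(Suc k := g)) m x \<le> lam x"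
      using patternsD(3)[OF P, of m x] patternsD(3)[OF P, of "Suc (Suc k)" x] up[of j i]
      by (auto simp: x)
  next
    fix m j i
    show "(P(Suc k := g)) (Suc m) (j, Suc i) \<le> (P(Suc k := g)) m (j, i)"
      using patternsD(2)[OF P, of m j i] l[of j i] u[of j i] by auto
  next
    fix m
    show "sum ((P(Suc k := g)) m) cells = (B(Suc k := B (Suc k) - 1)) m"
      using s patternsD(4)[OF P, of m] by auto
  qed
qed

text \<open>Together with \<open>level_upper\<close>: the box that interlacing with levels
  \<open>k\<close> and \<open>Suc (Suc k)\<close> leaves for level \<open>Suc k\<close>. Row 0 is
  separate in \<open>level_upper\<close> because no row lies above it.\<close>

definition level_lower :: "(nat \<Rightarrow> nat \<times> nat \<Rightarrow> nat) \<Rightarrow> nat \<Rightarrow> nat \<times> nat \<Rightarrow> nat" where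
  "level_lower P k x = max (P (Suc (Suc k)) (fst x, Suc (snd x))) (P k x)"

definition level_upper :: "(nat \<Rightarrow> nat \<times> nat \<Rightarrow> nat) \<Rightarrow> nat \<Rightarrow> nat \<times> nat \<Rightarrow> nat" where
  "level_upper P k x = (case snd x of 0 \<Rightarrow> P (Suc (Suc k)) (fst x, 0)
     | Suc i \<Rightarrow> min (P (Suc (Suc k)) (fst x, Suc i)) (P k (fst x, i)))"

lemma level_bounds:
  assumes P: "P \<in> patterns B"
  shows "level_lower P k x \<le> P (Suc k) x" "P (Suc k) x \<le> level_upper P k x"
proof -
  obtain j i where x: "x = (j, i)" by (cases x)
  show "level_lower P k x \<le> P (Suc k) x"
    using patternsD(1,2)[OF P] by (simp add: x level_lower_def)
  show "P (Suc k) x \<le> level_upper P k x"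
    using patternsD(1,2)[OF P] by (simp add: x level_upper_def split: nat.split)
qed

lemma sum_level_bounds:
  assumes P: "P \<in> patterns B"
  shows "sum (level_lower P k) cells + sum (level_upper P k) cells = B k + B (Suc (Suc k))"
proof -
  \<comment> \<open>Row \<open>N\<close> is empty, so the surplus terms of index \<open>N\<close> in
    \<open>sum_interlacing_bounds\<close> vanish.\<close>
  have zero: "P m (j, N) = 0" for m j
    using patternsD(3)[OF P, of m "(j, N)"] lam_outside[of "(j, N)"] by simp
  have "(\<Sum>i<N. level_lower P k (j, i)) + (\<Sum>i<N. level_upper P k (j, i)) =
      (\<Sum>i<N. P (Suc (Suc k)) (j, i)) + (\<Sum>i<N. P k (j, i))" for j
    using sum_interlacing_bounds[of "\<lambda>i. P (Suc (Suc k)) (j, i)" "\<lambda>i. P k (j, i)" N] zero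
    by (cases N) (simp_all add: level_lower_def level_upper_def lessThan_Suc cong: nat.case_cong)
  then have "(\<Sum>j<r. (\<Sum>i<N. level_lower P k (j, i)) + (\<Sum>i<N. level_upper P k (j, i))) =
      (\<Sum>j<r. (\<Sum>i<N. P (Suc (Suc k)) (j, i)) + (\<Sum>i<N. P k (j, i)))" by simp
  then show ?thesis
    using patternsD(4)[OF P, of k] patternsD(4)[OF P, of "Suc (Suc k)"]
    by (simp add: sum.distrib sum.cartesian_product)
qed

text \<open>With the other levels fixed, level \<open>Suc k\<close> ranges over the points of a box with prescribed
  coordinate sum, and strict concavity of \<open>B\<close> says that this sum exceeds the middle of the box.\<close>

lemma multiple_lower:
  assumes M: "multiple B" and conc: "B k + B (Suc (Suc k)) < 2 * B (Suc k)"
  shows "multiple (B(Suc k := B (Suc k) - 1))"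
proof -
  obtain P Q where P: "P \<in> patterns B" and Q: "Q \<in> patterns B" and ne: "P \<noteq> Q"
    using M by (auto simp: multiple_def)
  have update: "R(Suc k := g) \<in> patterns (B(Suc k := B (Suc k) - 1))"
    if R: "R \<in> patterns B" and "\<And>x. level_lower R k x \<le> g x" "\<And>x. g x \<le> level_upper R k x"
      "sum g cells + 1 = B (Suc k)" for R g
  proof (rule pattern_update[OF R])
    fix j i
    show "max (R (Suc (Suc k)) (j, Suc i)) (R k (j, i)) \<le> g (j, i)"
      using that(2)[of "(j, i)"] by (simp add: level_lower_def)
    show "g (j, 0) \<le> R (Suc (Suc k)) (j, 0)"
      using that(3)[of "(j, 0)"] by (simp add: level_upper_def)
    show "g (j, Suc i) \<le> min (R (Suc (Suc k)) (j, Suc i)) (R k (j, i))"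
      using that(3)[of "(j, Suc i)"] by (simp add: level_upper_def)
  qed (use that in simp)
  \<comment> \<open>Patterns that differ at another level stay distinct however level
    \<open>Suc k\<close> is lowered. Otherwise both have the same box at level \<open>Suc k\<close>,
    and \<open>two_lowered\<close> applies.\<close>
  show ?thesis
  proof (cases "\<exists>m. m \<noteq> Suc k \<and> P m \<noteq> Q m")
    case True
    have ex: "\<exists>g. R(Suc k := g) \<in> patterns (B(Suc k := B (Suc k) - 1))" if R: "R \<in> patterns B" for R
    proof -
      \<comment> \<open>A point above the middle of its box is not the bottom corner, so some
        coordinate can be lowered.\<close>
      have "sum (R (Suc k)) cells \<le> sum (level_upper R k) cells"
        by (intro sum_mono level_bounds[OF R])
      then have "sum (level_lower R k) cells < sum (R (Suc k)) cells"
        using sum_level_bounds[OF R, of k] conc patternsD(4)[OF R, of "Suc k"] by linarith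
      then obtain p where p: "p \<in> cells" "level_lower R k p < R (Suc k) p"
        by (rule exists_above_lower_bound)
      note low = lower_one[where l = "level_lower R k" and u = "level_upper R k",
          OF finite_cells p level_bounds[OF R]]
      show ?thesis
        using update[OF R low(2,3)] low(1) patternsD(4)[OF R, of "Suc k"] by auto
    qed
    obtain g h where g: "P(Suc k := g) \<in> patterns (B(Suc k := B (Suc k) - 1))"
      and h: "Q(Suc k := h) \<in> patterns (B(Suc k := B (Suc k) - 1))"
      using ex P Q by blast
    have "P(Suc k := g) \<noteq> Q(Suc k := h)" using True by (metis fun_upd_other)
    then show ?thesis using g h by (auto simp: multiple_def)
  next
    case False
    have eq: "P m = Q m" if "m \<noteq> Suc k" for m using False that by blast
    have neq: "P (Suc k) \<noteq> Q (Suc k)" using ne eq by (metis ext)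
    have bnd: "level_lower Q k = level_lower P k" "level_upper Q k = level_upper P k"
      using eq by (auto simp: level_lower_def level_upper_def fun_eq_iff split: nat.split)
    have lq: "level_lower P k x \<le> Q (Suc k) x" "Q (Suc k) x \<le> level_upper P k x" for x
      using level_bounds[OF Q, of k x] by (simp_all add: bnd)
    have off: "P (Suc k) x = Q (Suc k) x" if "x \<notin> cells" for x
      using patternsD(3)[OF P, of "Suc k" x] patternsD(3)[OF Q, of "Suc k" x] lam_outside[OF that]
      by simp
    have s: "sum (P (Suc k)) cells = sum (Q (Suc k)) cells"
      using patternsD(4)[OF P] patternsD(4)[OF Q] by simp
    have mid: "sum (level_lower P k) cells + sum (level_upper P k) cells < 2 * sum (P (Suc k)) cells"
      using sum_level_bounds[OF P, of k] conc patternsD(4)[OF P, of "Suc k"] by simp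
    obtain g h where gh: "g \<noteq> h"
      "\<forall>z. level_lower P k z \<le> g z \<and> g z \<le> level_upper P k z"
      "\<forall>z. level_lower P k z \<le> h z \<and> h z \<le> level_upper P k z"
      "sum g cells + 1 = sum (P (Suc k)) cells" "sum h cells + 1 = sum (P (Suc k)) cells"
      using two_lowered[OF finite_cells level_bounds[OF P, of k] lq(1,2) neq _ s mid] off by blast
    have "P(Suc k := g) \<noteq> P(Suc k := h)" using gh(1) by (metis fun_upd_same)
    moreover have "P(Suc k := g) \<in> patterns (B(Suc k := B (Suc k) - 1))"
      using update[OF P, of g] gh(2,4) patternsD(4)[OF P] by simp
    moreover have "P(Suc k := h) \<in> patterns (B(Suc k := B (Suc k) - 1))"
      using update[OF P, of h] gh(3,5) patternsD(4)[OF P] by simp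
    ultimately show ?thesis by (auto simp: multiple_def)
  qed
qed

end

section \<open>First maxima and descent by unit steps\<close>

lemma strict_rise_to_max:
  fixes D :: "nat \<Rightarrow> nat"
  assumes "D 0 = 0" "\<And>m. m \<ge> M \<Longrightarrow> D m = 0" "D z \<noteq> 0"
  obtains k where "D k < D (Suc k)" "\<And>m. D m \<le> D (Suc k)"
proof -
  have bd: "D m \<le> Max (D ` {..M})" for m
    using assms(1) assms(2)[of m] by (cases "m \<le> M") auto
  have "Max (D ` {..M}) \<in> D ` {..M}" by (intro Max_in) auto
  then have ex: "\<exists>m. D m = Max (D ` {..M})" by (metis imageE)
  \<comment> \<open>At the first maximum the predecessor is strictly smaller.\<close>
  define m where "m = (LEAST m. D m = Max (D ` {..M}))"
  have m: "D m = Max (D ` {..M})" unfolding m_def using ex by (rule LeastI_ex)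
  have "m \<noteq> 0" using m bd[of z] assms(1,3) by (metis le_zero_eq)
  then obtain k where k: "m = Suc k" by (cases m) auto
  have "D k \<noteq> Max (D ` {..M})"
    using not_less_Least[of k "\<lambda>m. D m = Max (D ` {..M})"] k by (simp add: m_def)
  then have "D k < D (Suc k)" using bd[of k] m k by simp
  then show ?thesis using that[of k] bd m k by simp
qed

context multishape
begin

text \<open>At a place where \<open>B - C\<close> rises to its maximum, concavity of \<open>C\<close> forces \<open>B\<close> to be strictly
  concave, so \<open>B\<close> can be lowered there.\<close>

lemma multiple_mono:
  assumes "multiple B"
    and le: "\<And>m. C m \<le> B m" and C0: "B 0 = C 0" and CM: "\<And>m. m \<ge> M \<Longrightarrow> B m = C m"
    and conc: "\<And>k. C k + C (Suc (Suc k)) \<le> 2 * C (Suc k)"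
  shows "multiple C"
  using assms(1-4)
proof (induction "\<Sum>m<M. B m - C m" arbitrary: B rule: less_induct)
  case less
  show ?case
  proof (cases "B = C")
    case False
    then obtain z where "B z - C z \<noteq> 0"
      using less.prems(2) by (metis diff_is_0_eq ext le_antisym)
    then obtain k where k: "B k - C k < B (Suc k) - C (Suc k)"
        "\<And>m. B m - C m \<le> B (Suc k) - C (Suc k)"
      using strict_rise_to_max[of "\<lambda>m. B m - C m" M z] less.prems(3,4) by auto
    have strict: "B k + B (Suc (Suc k)) < 2 * B (Suc k)"
      using k(1) k(2)[of "Suc (Suc k)"] conc[of k] less.prems(2)[of k] less.prems(2)[of "Suc k"]
        less.prems(2)[of "Suc (Suc k)"] by linarith
    have kM: "Suc k < M"
      using k(1) less.prems(4)[of "Suc k"] by (cases "Suc k < M") auto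
    let ?B = "B(Suc k := B (Suc k) - 1)"
    have "(\<Sum>m<M. ?B m - C m) < (\<Sum>m<M. B m - C m)"
      using kM k(1) by (intro sum_strict_mono_ex1) auto
    moreover have "multiple ?B" using multiple_lower[OF less.prems(1) strict] .
    moreover have "C m \<le> ?B m" for m using less.prems(2)[of m] k(1) by auto
    moreover have "?B m = C m" if "m \<ge> M" for m using less.prems(4)[OF that] that kM by auto
    ultimately show ?thesis using less.hyps[of ?B] less.prems(3) by simp
  qed (use less.prems in simp)
qed

section \<open>Two patterns below the canonical level sums\<close>

abbreviation col :: "nat \<Rightarrow> nat" where
  "col i \<equiv> \<Sum>j<r. lam (j, i)"

lemma component_drop:
  assumes "col (Suc a) < col a"
  obtains j where "j < r" "lam (j, Suc a) < lam (j, a)"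
  using assms by (meson lessThan_iff linorder_not_less sum_mono)

lemma multiple_below_top:
  assumes le: "\<And>m. C m \<le> top_sum m" and C0: "C 0 = 0"
    and CM: "\<And>m. m \<ge> M \<Longrightarrow> top_sum m = C m"
    and conc: "\<And>k. C k + C (Suc (Suc k)) \<le> 2 * C (Suc k)"
    and ne: "C \<noteq> top_sum"
    and cond: "\<And>a. col a - col (Suc a) \<le> 1 \<or>
      (\<exists>j j'. j \<noteq> j' \<and> lam (j, Suc a) < lam (j, a) \<and> lam (j', Suc a) < lam (j', a))"
  shows "multiple C"
proof -
  define D where "D m = top_sum m - C m" for m
  have DM: "D m = 0" if "m \<ge> M" for m using CM[OF that] by (simp add: D_def)
  have top: "top_sum m = C m + D m" for m using le[of m] by (simp add: D_def)
  obtain z where "D z \<noteq> 0" using ne top by (metis add.right_neutral ext)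
  then obtain a where a: "D a < D (Suc a)" "\<And>m. D m \<le> D (Suc a)"
    using strict_rise_to_max[of D M z] DM top_sum_0 by (auto simp: D_def)
  have second: "2 * top_sum (Suc i) + col (Suc i) = top_sum i + top_sum (Suc (Suc i)) + col i" for i
    by (simp add: top_sum_Suc)
  \<comment> \<open>The drop of \<open>col\<close> is the negated second difference of
    \<open>top_sum = C + D\<close>. As \<open>C\<close> is concave, strict concavity of
    \<open>D\<close> makes it positive.\<close>
  have drop: "col (Suc i) < col i" if "D i + D (Suc (Suc i)) < 2 * D (Suc i)" for i
    using second[of i] top[of i] top[of "Suc i"] top[of "Suc (Suc i)"] conc[of i] that by linarith
  obtain B where B: "multiple B" "\<And>m. C m \<le> B m" "B 0 = C 0" "\<And>m. m \<ge> M \<Longrightarrow> B m = C m"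
  proof (cases "col a - col (Suc a) \<le> 1")
    case False
    then have "multiple (\<lambda>t. top_sum t - (if t = Suc a then 1 else 0))"
      using cond[of a] multiple_two_components by blast
    moreover have "C m \<le> top_sum m - (if m = Suc a then 1 else 0)" for m
      using top[of m] a(1) by auto
    moreover have "top_sum m - (if m = Suc a then 1 else 0) = C m" if "m \<ge> M" for m
      using DM[OF that] top[of m] a(1) by auto
    ultimately show ?thesis using that C0 top_sum_0 by simp
  next
    case True
    \<comment> \<open>The drop of \<open>col\<close> at \<open>a\<close> is at least
      \<open>D (Suc a) - D a\<close> plus \<open>D (Suc a) - D (Suc (Suc a))\<close>. The first
      difference is already at least 1, so the second one is 0.\<close>
    have plateau: "D (Suc (Suc a)) = D (Suc a)"
      using True second[of a] top[of a] top[of "Suc a"] top[of "Suc (Suc a)"] conc[of a] a(1)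
        a(2)[of "Suc (Suc a)"] by linarith
    have ex: "\<exists>t>a. D (Suc t) \<noteq> D (Suc a)"
      using DM[of "Suc (M + a + 1)"] a(1) by (intro exI[of _ "M + a + 1"]) auto
    \<comment> \<open>\<open>Suc b\<close> is the first place after the plateau; with
      \<open>b = Suc c\<close> the plateau runs from \<open>Suc a\<close> to \<open>Suc c\<close>.
      At both of its ends \<open>D\<close> is strictly concave, so \<open>col\<close> drops at
      \<open>a\<close> and at \<open>c\<close>.\<close>
    define b where "b = (LEAST t. t > a \<and> D (Suc t) \<noteq> D (Suc a))"
    have b: "b > a" "D (Suc b) \<noteq> D (Suc a)"
      using LeastI_ex[OF ex] by (auto simp: b_def)
    have run: "D (Suc t) = D (Suc a)" if "a \<le> t" "t < b" for t
      using not_less_Least[of t "\<lambda>t. t > a \<and> D (Suc t) \<noteq> D (Suc a)"] that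
      by (cases "t = a") (auto simp: b_def)
    obtain c where c: "b = Suc c" using b by (cases b) auto
    have ac: "a < c" using plateau b c by (cases "a = c") auto
    have Dc: "D (Suc c) = D (Suc a)" using run[of c] ac c by simp
    have "D (Suc (Suc c)) < D (Suc a)" using b a(2)[of "Suc b"] c by simp
    then have "col (Suc c) < col c"
      using drop[of c] Dc a(2)[of c] by linarith
    moreover have "col (Suc a) < col a" using drop[of a] plateau a(1) by linarith
    ultimately obtain j j' where "lam (j, Suc a) < lam (j, a)" "lam (j', Suc c) < lam (j', c)"
      using component_drop by metis
    then have "multiple (\<lambda>t. top_sum t - (if Suc a \<le> t \<and> t \<le> Suc c then 1 else 0))"
      using multiple_two_levels[OF ac] by blast
    \<comment> \<open>On the whole plateau \<open>D\<close> is positive, so lowering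
      \<open>top_sum\<close> by one there stays above \<open>C\<close>.\<close>
    moreover have pos: "D m > 0" if "Suc a \<le> m" "m \<le> Suc c" for m
      using that run[of "m - 1"] c a(1) by (cases m) auto
    then have "C m \<le> top_sum m - (if Suc a \<le> m \<and> m \<le> Suc c then 1 else 0)" for m
      using top[of m] pos[of m] by fastforce
    moreover have "top_sum m - (if Suc a \<le> m \<and> m \<le> Suc c then 1 else 0) = C m" if "m \<ge> M" for m
      using DM[OF that] top[of m] pos[of m] by auto
    ultimately show ?thesis using that C0 top_sum_0 by simp
  qed
  then show ?thesis using multiple_mono[OF B conc] by simp
qed

end


section \<open>Patterns and multitableaux\<close>

text \<open>In a sorted list the entries at most \<open>m\<close> form a prefix, so a row can be
  recovered from its counts.\<close>

lemma nth_le_iff_less_count: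
  assumes "sorted xs" "c < length xs"
  shows "xs ! c \<le> m \<longleftrightarrow> c < length (filter (\<lambda>e. e \<le> m) xs)"
  using assms
proof (induction xs arbitrary: c)
  case (Cons a xs)
  show ?case
  proof (cases "a \<le> m")
    case True
    then show ?thesis using Cons by (cases c) auto
  next
    case False
    then have "filter (\<lambda>e. e \<le> m) xs = []"
      using Cons.prems(1) by (force simp: filter_empty_conv)
    moreover have "a \<le> (a # xs) ! c"
      using Cons.prems by (cases c) auto
    ultimately show ?thesis using False by simp
  qed
qed simp

lemma length_filter_le_Suc:
  "length (filter (\<lambda>e. e \<le> Suc m) xs) = length (filter (\<lambda>e. e \<le> m) xs) + count_list xs (Suc m)"
  by (induction xs) auto

lemma sum_weight:
  assumes "\<forall>row\<in>set T. \<forall>x\<in>set row. 1 \<le> x"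
  shows "(\<Sum>t<m. weight T (Suc t)) = (\<Sum>i<length T. length (filter (\<lambda>e. e \<le> m) (T ! i)))"
proof -
  have "(\<Sum>t<m. weight T (Suc t)) = length (filter (\<lambda>e. e \<le> m) (concat T))"
  proof (induction m)
    case 0
    have "filter (\<lambda>e. e \<le> 0) (concat T) = []"
      using assms by (fastforce simp: filter_empty_conv)
    then show ?case by simp
  qed (simp add: length_filter_le_Suc weight_def)
  also have "\<dots> = (\<Sum>row\<leftarrow>T. length (filter (\<lambda>e. e \<le> m) row))"
    by (simp add: filter_concat length_concat comp_def)
  also have "\<dots> = (\<Sum>i<length T. length (filter (\<lambda>e. e \<le> m) (T ! i)))"
    by (simp add: sum_list_sum_nth atLeast0LessThan)
  finally show ?thesis .
qed

lemma length_filter_less_upt: "p \<le> q \<Longrightarrow> length (filter (\<lambda>c. c < p) [0..<q]) = (p::nat)"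
proof -
  assume "p \<le> q"
  then have "{c. c < q \<and> c < p} = {..<p}" by auto
  then show ?thesis by (simp add: length_filter_conv_card cong: conj_cong)
qed

definition shape :: "nat list list \<Rightarrow> nat \<times> nat \<Rightarrow> nat" where
  "shape L x = (if fst x < length L then part (L ! fst x) (Suc (snd x)) else 0)"

definition pattern_of :: "nat list list list \<Rightarrow> nat \<Rightarrow> nat \<times> nat \<Rightarrow> nat" where
  "pattern_of Ts m x = (if fst x < length Ts \<and> snd x < length (Ts ! fst x)
     then length (filter (\<lambda>e. e \<le> m) (Ts ! fst x ! snd x)) else 0)"

text \<open>The inverse of \<open>pattern_of\<close>: column \<open>c\<close> receives the first
  level at which its row has more than \<open>c\<close> entries.\<close>

definition tableaux_of :: "nat list list \<Rightarrow> (nat \<Rightarrow> nat \<times> nat \<Rightarrow> nat) \<Rightarrow> nat list list list" where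
  "tableaux_of L P = map (\<lambda>j. map (\<lambda>i. map (\<lambda>c. LEAST m. c < P m (j, i)) [0..<shape L (j, i)])
     [0..<length (L ! j)]) [0..<length L]"

section \<open>Partitions and their partial sums\<close>

definition partial_sums :: "nat list \<Rightarrow> nat \<Rightarrow> nat" where
  "partial_sums mu m = (\<Sum>t<m. part mu (Suc t))"

lemma part_Suc: "i < length lam \<Longrightarrow> part lam (Suc i) = lam ! i"
  by (simp add: part_def)

lemma part_Suc_Suc_le:
  assumes "is_partition_of k lam"
  shows "part lam (Suc (Suc i)) \<le> part lam (Suc i)"
  using assms by (auto simp: part_def is_partition_of_def sorted_wrt_iff_nth_less)

lemma partial_sums_stable:
  assumes "is_partition_of n mu" "length mu \<le> m"
  shows "partial_sums mu m = n"
proof -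
  have "partial_sums mu m = (\<Sum>i\<in>{1..<Suc m}. part mu i)"
    using sum.shift_bounds_Suc_ivl[of "part mu" 0 m] by (simp add: partial_sums_def atLeast0LessThan)
  then show ?thesis
    using sum_list_eq_sum_part[OF assms(2)] assms(1) by (simp add: is_partition_of_def)
qed

lemma partial_sums_concave:
  assumes "is_partition_of n mu"
  shows "partial_sums mu k + partial_sums mu (Suc (Suc k)) \<le> 2 * partial_sums mu (Suc k)"
  using part_Suc_Suc_le[OF assms, of k] by (simp add: partial_sums_def)

lemma length_le_if_parts_eq:
  assumes "is_partition_of a lam" "\<And>i. part lam (Suc i) = part mu (Suc i)"
  shows "length lam \<le> length mu"
proof (rule ccontr)
  assume "\<not> length lam \<le> length mu"
  then have "part lam (Suc (length mu)) > 0" "part mu (Suc (length mu)) = 0"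
    using assms(1) by (auto simp: part_def is_partition_of_def)
  then show False using assms(2) by simp
qed

lemma partition_eqI:
  assumes "is_partition_of a lam" "is_partition_of b mu" "\<And>i. part lam (Suc i) = part mu (Suc i)"
  shows "lam = mu"
proof (rule nth_equalityI)
  show len: "length lam = length mu"
    using length_le_if_parts_eq[OF assms(1,3)] length_le_if_parts_eq[OF assms(2) assms(3)[symmetric]] by simp
  show "lam ! i = mu ! i" if "i < length lam" for i
    using assms(3)[of i] that len by (simp add: part_Suc)
qed

lemma part_eq_partial_sums_diff: "part mu (Suc t) = partial_sums mu (Suc t) - partial_sums mu t"
  by (simp add: partial_sums_def)

lemma partial_sums_inj:
  assumes "is_partition_of a lam" "is_partition_of b mu" "partial_sums lam = partial_sums mu"
  shows "lam = mu"
  using assms by (intro partition_eqI) (auto simp: part_eq_partial_sums_diff)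

text \<open>Stopping the list at the first zero of \<open>f\<close> keeps all parts positive and
  loses nothing, as \<open>f\<close> vanishes from there on.\<close>

lemma partition_exists:
  assumes dec: "\<And>t. f (Suc t) \<le> f t" and "f M = (0::nat)"
  obtains mu where "is_partition_of (\<Sum>t<M. f t) mu" "\<And>t. part mu (Suc t) = f t"
proof -
  define k where "k = (LEAST k. f k = 0)"
  have k: "f k = 0" unfolding k_def using assms(2) by (rule LeastI)
  have pos: "0 < f t" if "t < k" for t
    using not_less_Least[of t "\<lambda>k. f k = 0"] that by (simp add: k_def)
  have anti: "f b \<le> f a" if "a \<le> b" for a b
    using that dec by (rule lift_Suc_antimono_le[rotated])
  have zero: "f t = 0" if "k \<le> t" for t using anti[OF that] k by simp
  have "k \<le> M" unfolding k_def using assms(2) by (rule Least_le)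
  then have "(\<Sum>t<M. f t) = (\<Sum>t<k. f t)"
    using zero by (intro sum.mono_neutral_right) auto
  moreover have "sum_list (map f [0..<k]) = (\<Sum>t<k. f t)"
    by (simp add: interv_sum_list_conv_sum_set_nat atLeast0LessThan)
  moreover have "sorted_wrt (\<ge>) (map f [0..<k])"
    by (auto simp: sorted_wrt_iff_nth_less intro: anti)
  ultimately have "is_partition_of (\<Sum>t<M. f t) (map f [0..<k])"
    using pos by (auto simp: is_partition_of_def)
  moreover have "part (map f [0..<k]) (Suc t) = f t" for t
    using zero by (auto simp: part_def)
  ultimately show ?thesis by (rule that)
qed

section \<open>The bijection for a given multipartition\<close>

locale multipartition =
  fixes r n :: nat and L :: "nat list list" and N :: nat
  assumes multi: "is_multipartition_of r n L"
    and length_le: "lam \<in> set L \<Longrightarrow> length lam \<le> N"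
begin

lemma length_L: "length L = r"
  using multi by (simp add: is_multipartition_of_def)

lemma component_partition: "j < r \<Longrightarrow> is_partition_of (sum_list (L ! j)) (L ! j)"
  using multi nth_mem[of j L] by (auto simp: is_multipartition_of_def)

lemma length_component_le: "j < r \<Longrightarrow> length (L ! j) \<le> N"
  using length_le length_L by simp

sublocale multishape r N "shape L"
proof
  fix x assume "x \<notin> {..<r} \<times> {..<N}"
  then show "shape L x = 0"
    using length_component_le[of "fst x"] length_L by (cases x) (auto simp: shape_def part_def)
next
  fix j i show "shape L (j, Suc i) \<le> shape L (j, i)"
    using part_Suc_Suc_le[OF component_partition] length_L by (simp add: shape_def)
qed

lemma col_eq: "(\<Sum>j<r. shape L (j, i)) = part (lam_tilde L) (Suc i)"
  by (simp add: part_lam_tilde sum_list_sum_nth atLeast0LessThan length_L shape_def)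

lemma top_sum_eq: "top_sum = partial_sums (lam_tilde L)"
proof
  show "top_sum m = partial_sums (lam_tilde L) m" for m
    by (induction m) (simp_all add: top_sum_0 top_sum_Suc col_eq partial_sums_def)
qed

lemma sum_shape: "sum (shape L) cells = n"
proof -
  have "sum (shape L) cells = top_sum N"
    unfolding top_sum_def by (intro sum.cong) (auto simp: top_pattern_def)
  \<comment> \<open>The larger index only adds zero terms and is at least the length of
    \<open>lam_tilde L\<close>, as \<open>partial_sums_stable\<close> requires.\<close>
  also have "\<dots> = partial_sums (lam_tilde L) (N + length (lam_tilde L))"
    unfolding top_sum_eq partial_sums_def
    by (intro sum.mono_neutral_left)
       (auto simp: col_eq[symmetric] sum.neutral lam_outside)
  also have "\<dots> = n"
    by (intro partial_sums_stable is_partition_of_lam_tilde[OF multi]) simp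
  finally show ?thesis .
qed

lemma multitableauxD:
  assumes "Ts \<in> multitableaux L mu"
  shows "length Ts = r" "j < r \<Longrightarrow> semistandard (L ! j) (Ts ! j)"
    "part mu (Suc t) = (\<Sum>j<r. weight (Ts ! j) (Suc t))"
proof -
  have len: "length Ts = r" and "list_all2 semistandard L Ts"
    using assms length_L by (auto simp: multitableaux_def list_all2_lengthD)
  then show "length Ts = r" "j < r \<Longrightarrow> semistandard (L ! j) (Ts ! j)"
    using length_L by (auto simp: list_all2_nthD)
  show "part mu (Suc t) = (\<Sum>j<r. weight (Ts ! j) (Suc t))"
    using assms len by (simp add: multitableaux_def sum_list_sum_nth atLeast0LessThan)
qed

lemma semistandardD:
  assumes "semistandard (L ! j) T" "j < r"
  shows "length T = length (L ! j)" "i < length T \<Longrightarrow> length (T ! i) = shape L (j, i)"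
    "i < length T \<Longrightarrow> sorted (T ! i)" "\<forall>row\<in>set T. \<forall>x\<in>set row. 1 \<le> x"
    "Suc i < length T \<Longrightarrow> c < length (T ! Suc i) \<Longrightarrow> T ! i ! c < T ! Suc i ! c"
proof -
  show len: "length T = length (L ! j)"
    using assms unfolding semistandard_def by (metis length_map)
  show "length (T ! i) = shape L (j, i)" if "i < length T"
  proof -
    have "map length T ! i = L ! j ! i" using assms by (simp add: semistandard_def)
    then show ?thesis using that len assms(2) length_L by (simp add: shape_def part_Suc)
  qed
qed (use assms in \<open>auto simp: semistandard_def\<close>)

lemma sum_pattern_of:
  assumes "length Ts = r" "\<And>j. j < r \<Longrightarrow> semistandard (L ! j) (Ts ! j)"
  shows "sum (pattern_of Ts m) cells = (\<Sum>t<m. \<Sum>j<r. weight (Ts ! j) (Suc t))"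
proof -
  have "sum (pattern_of Ts m) cells = (\<Sum>j<r. \<Sum>i<N. pattern_of Ts m (j, i))"
    by (simp add: sum.cartesian_product)
  also have "\<dots> = (\<Sum>j<r. \<Sum>t<m. weight (Ts ! j) (Suc t))"
  proof (rule sum.cong[OF refl])
    fix j assume "j \<in> {..<r}"
    then have j: "j < r" by simp
    note T = semistandardD[OF assms(2)[OF j] j]
    have "(\<Sum>i<N. pattern_of Ts m (j, i)) = (\<Sum>i<length (Ts ! j). pattern_of Ts m (j, i))"
      using length_component_le[OF j] T(1)
      by (intro sum.mono_neutral_right) (auto simp: pattern_of_def)
    also have "\<dots> = (\<Sum>t<m. weight (Ts ! j) (Suc t))"
      unfolding sum_weight[OF T(4)] using j assms(1) by (intro sum.cong) (auto simp: pattern_of_def)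
    finally show "(\<Sum>i<N. pattern_of Ts m (j, i)) = (\<Sum>t<m. weight (Ts ! j) (Suc t))" .
  qed
  also have "\<dots> = (\<Sum>t<m. \<Sum>j<r. weight (Ts ! j) (Suc t))" by (rule sum.swap)
  finally show ?thesis .
qed

lemma pattern_of_mem:
  assumes Ts: "Ts \<in> multitableaux L mu"
  shows "pattern_of Ts \<in> patterns (partial_sums mu)"
  unfolding patterns_def
proof (intro CollectI conjI allI)
  note T = multitableauxD[OF Ts]
  fix m and x :: "nat \<times> nat"
  obtain j i where x: "x = (j, i)" by (cases x)
  show "pattern_of Ts m x \<le> pattern_of Ts (Suc m) x"
    by (simp add: pattern_of_def length_filter_le_Suc)
  show "pattern_of Ts m x \<le> shape L x"
    using semistandardD(2)[OF T(2), of j i] T(1)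
    by (cases "i < length (Ts ! j)")
       (auto simp: x pattern_of_def intro: order_trans[OF length_filter_le])
next
  note T = multitableauxD[OF Ts]
  fix m j i
  show "pattern_of Ts (Suc m) (j, Suc i) \<le> pattern_of Ts m (j, i)"
  proof (cases "j < r \<and> Suc i < length (Ts ! j)")
    case True
    note S = semistandardD[OF T(2), of j]
    let ?p = "\<lambda>m i. length (filter (\<lambda>e. e \<le> m) (Ts ! j ! i))"
    \<comment> \<open>An entry at most \<open>Suc m\<close> in row \<open>Suc i\<close> lies below a
      strictly smaller entry, which is at most \<open>m\<close>.\<close>
    have "c < ?p m i" if c: "c < ?p (Suc m) (Suc i)" for c
    proof -
      have c1: "c < length (Ts ! j ! Suc i)"
        using c length_filter_le[of "\<lambda>e. e \<le> Suc m" "Ts ! j ! Suc i"] by linarith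
      then have c0: "c < length (Ts ! j ! i)"
        using S(2)[of i] S(2)[of "Suc i"] True lam_Suc_le[of j i] by simp
      have "Ts ! j ! Suc i ! c \<le> Suc m"
        using nth_le_iff_less_count[OF S(3) c1] True c by simp
      moreover have "Ts ! j ! i ! c < Ts ! j ! Suc i ! c"
        using S(5)[of i c] True c1 by simp
      ultimately show ?thesis
        using nth_le_iff_less_count[OF S(3) c0, of m] True by simp
    qed
    then have "?p (Suc m) (Suc i) \<le> ?p m i"
      by (meson less_irrefl not_le)
    then show ?thesis using True T(1) by (simp add: pattern_of_def)
  qed (use T(1) in \<open>auto simp: pattern_of_def\<close>)
next
  note T = multitableauxD[OF Ts]
  show "sum (pattern_of Ts m) cells = partial_sums mu m" for m
    by (simp add: sum_pattern_of[OF T(1,2)] T(3) partial_sums_def)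
qed

lemma pattern_of_inj: "inj_on pattern_of (multitableaux L mu)"
proof (rule inj_onI)
  fix Ts Us
  assume "Ts \<in> multitableaux L mu" "Us \<in> multitableaux L mu" and eq: "pattern_of Ts = pattern_of Us"
  note T = multitableauxD(1,2)[OF this(1)] and U = multitableauxD(1,2)[OF this(2)]
  show "Ts = Us"
  proof (intro nth_equalityI)
    show "length Ts = length Us" using T U by simp
    fix j assume "j < length Ts"
    then have j: "j < r" using T by simp
    note TS = semistandardD[OF T(2)[OF j] j] and US = semistandardD[OF U(2)[OF j] j]
    show lenj: "length (Ts ! j) = length (Us ! j)" using TS(1) US(1) by simp
    fix i assume i: "i < length (Ts ! j)"
    then have i': "i < length (Us ! j)" using lenj by simp
    show leni: "length (Ts ! j ! i) = length (Us ! j ! i)"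
      using TS(2)[OF i] US(2)[OF i'] by simp
    fix c assume c: "c < length (Ts ! j ! i)"
    then have c': "c < length (Us ! j ! i)" using leni by simp
    \<comment> \<open>An entry is determined by the thresholds \<open>m\<close> that it does not
      exceed, and the pattern records these.\<close>
    have "Ts ! j ! i ! c \<le> m \<longleftrightarrow> Us ! j ! i ! c \<le> m" for m
      unfolding nth_le_iff_less_count[OF TS(3)[OF i] c] nth_le_iff_less_count[OF US(3)[OF i'] c']
      using fun_cong[OF fun_cong[OF eq, of m], of "(j, i)"] T(1) U(1) j i i'
      by (simp add: pattern_of_def)
    then show "Ts ! j ! i ! c = Us ! j ! i ! c" by (meson le_antisym order_refl)
  qed
qed

lemma tableaux_of_mem:
  assumes mu: "is_partition_of n mu" and P: "P \<in> patterns (partial_sums mu)"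
  shows "tableaux_of L P \<in> multitableaux L mu" "pattern_of (tableaux_of L P) = P"
proof -
  define entry where "entry j i c = (LEAST m. c < P m (j, i))" for j i c
  define Ts where "Ts = tableaux_of L P"
  \<comment> \<open>By this level all \<open>n\<close> cells are filled, so the \<open>LEAST\<close>
    defining an entry of a cell is attained.\<close>
  have full: "P (length mu) = shape L"
    using patternsD(3,4)[OF P] sum_shape partial_sums_stable[OF mu order_refl]
    by (intro eq_if_le_sum_eq) simp_all
  have zero: "P 0 = (\<lambda>x. 0)"
    using patternsD(3,4)[OF P] by (intro eq_if_le_sum_eq[symmetric]) (simp_all add: partial_sums_def)
  have mono: "P a x \<le> P b x" if "a \<le> b" for a b x
    using that patternsD(1)[OF P] by (rule lift_Suc_mono_le[rotated])
  \<comment> \<open>This equivalence translates the pattern inequalities into sorted rows, strict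
    columns and, by \<open>P 0 = 0\<close>, positive entries.\<close>
  have entry_le: "entry j i c \<le> m \<longleftrightarrow> c < P m (j, i)" if "c < shape L (j, i)" for j i c m
  proof
    have "c < P (entry j i c) (j, i)"
      unfolding entry_def using that full by (intro LeastI[of "\<lambda>m. c < P m (j, i)" "length mu"]) simp
    then show "c < P m (j, i)" if "entry j i c \<le> m"
      using mono[OF that, of "(j, i)"] by simp
  qed (auto simp: entry_def intro: Least_le)
  have len: "length Ts = r" by (simp add: Ts_def tableaux_of_def length_L)
  have lenj: "length (Ts ! j) = length (L ! j)" if "j < r" for j
    using that by (simp add: Ts_def tableaux_of_def length_L)
  have row: "Ts ! j ! i = map (entry j i) [0..<shape L (j, i)]" if "j < r" "i < length (L ! j)" for j i
    using that by (simp add: Ts_def tableaux_of_def length_L entry_def)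
  have ss: "semistandard (L ! j) (Ts ! j)" if j: "j < r" for j
    unfolding semistandard_def
  proof (intro conjI allI ballI impI)
    show "map length (Ts ! j) = L ! j"
      using j by (intro nth_equalityI) (simp_all add: lenj row shape_def length_L part_Suc)
    fix R assume "R \<in> set (Ts ! j)"
    then obtain i where i: "i < length (L ! j)" "R = Ts ! j ! i"
      using lenj[OF j] by (metis in_set_conv_nth)
    show "1 \<le> e" if e: "e \<in> set R" for e
    proof -
      obtain c where "c < shape L (j, i)" "e = entry j i c"
        using e i row[OF j i(1)] by auto
      then show ?thesis using entry_le[of c j i 0] zero by simp
    qed
    show "sorted R"
      unfolding i(2) row[OF j i(1)] sorted_iff_nth_mono
    proof (intro allI impI)
      fix a b assume ab: "a \<le> b" "b < length (map (entry j i) [0..<shape L (j, i)])"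
      then have "entry j i a \<le> entry j i b"
        using entry_le[of a j i "entry j i b"] entry_le[of b j i "entry j i b"] by simp
      then show "map (entry j i) [0..<shape L (j, i)] ! a \<le> map (entry j i) [0..<shape L (j, i)] ! b"
        using ab by simp
    qed
  next
    fix i c assume *: "Suc i < length (Ts ! j) \<and> c < length (Ts ! j ! Suc i)"
    then have i: "i < length (L ! j)" "Suc i < length (L ! j)" using lenj[OF j] by auto
    have c: "c < shape L (j, Suc i)" using * row[OF j i(2)] by simp
    then have c0: "c < shape L (j, i)" using lam_Suc_le[of j i] by simp
    have "0 < entry j (Suc i) c" using entry_le[OF c, of 0] zero by simp
    then obtain m where m: "entry j (Suc i) c = Suc m" by (cases "entry j (Suc i) c") auto
    then have "c < P (Suc m) (j, Suc i)" using entry_le[OF c, of "Suc m"] by simp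
    then have "c < P m (j, i)" using patternsD(2)[OF P, of m j i] by simp
    then have "entry j i c \<le> m" using entry_le[OF c0] by simp
    then show "Ts ! j ! i ! c < Ts ! j ! Suc i ! c"
      using m row[OF j i(1)] row[OF j i(2)] c c0 by simp
  qed
  have pat: "pattern_of Ts = P"
  proof (intro ext)
    fix m and x :: "nat \<times> nat"
    obtain j i where x: "x = (j, i)" by (cases x)
    show "pattern_of Ts m x = P m x"
    proof (cases "j < r \<and> i < length (L ! j)")
      case True
      have "filter (\<lambda>c. entry j i c \<le> m) [0..<shape L (j, i)] =
          filter (\<lambda>c. c < P m (j, i)) [0..<shape L (j, i)]"
        using entry_le by (intro filter_cong) auto
      then show ?thesis
        using True row[of j i] length_filter_less_upt[OF patternsD(3)[OF P, of m "(j, i)"]]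
        by (simp add: x pattern_of_def len lenj filter_map comp_def)
    next
      case False
      then have "shape L (j, i) = 0" using length_L by (auto simp: shape_def part_def)
      then show ?thesis
        using False patternsD(3)[OF P, of m "(j, i)"] by (auto simp: x pattern_of_def len lenj)
    qed
  qed
  have wt: "(\<Sum>t<m. \<Sum>j<r. weight (Ts ! j) (Suc t)) = partial_sums mu m" for m
    using sum_pattern_of[OF len ss, of m] pat patternsD(4)[OF P] by simp
  have "part mu t = (\<Sum>T\<leftarrow>Ts. weight T t)" if t: "1 \<le> t" for t
  proof -
    obtain s where s: "t = Suc s" using t by (cases t) auto
    show ?thesis
      using wt[of s] wt[of "Suc s"]
      by (simp add: s part_eq_partial_sums_diff sum_list_sum_nth atLeast0LessThan len)
  qed
  moreover have "list_all2 semistandard L Ts"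
    using ss len length_L by (simp add: list_all2_conv_all_nth)
  ultimately show "tableaux_of L P \<in> multitableaux L mu"
    by (simp add: multitableaux_def Ts_def)
  show "pattern_of (tableaux_of L P) = P" using pat by (simp add: Ts_def)
qed

lemma multikostka_eq:
  assumes "is_partition_of n mu"
  shows "multikostka L mu = card (patterns (partial_sums mu))"
proof -
  have "pattern_of ` multitableaux L mu = patterns (partial_sums mu)"
    using pattern_of_mem tableaux_of_mem[OF assms] by (force simp: image_iff)
  then show ?thesis
    unfolding multikostka_def by (metis card_image pattern_of_inj)
qed

end

section \<open>Uniqueness in terms of the drops of \<open>lam_tilde L\<close>\<close>

theorem corollary5p2:
  fixes r n :: nat and L :: "nat list list"
  assumes "is_multipartition_of r n L"
  shows "{mu. is_partition_of n mu \<and> multikostka L mu = 1} = {lam_tilde L} \<longleftrightarrow>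
    (\<forall>i\<ge>1.
       part (lam_tilde L) i - part (lam_tilde L) (i + 1) \<le> 1 \<or>
       2 \<le> card {j. j < r \<and> 1 \<le> part (L ! j) i - part (L ! j) (i + 1)})"
    (is "?U = {?lt} \<longleftrightarrow> (\<forall>i\<ge>1. ?cond i)")
proof -
  interpret multipartition r n L "Max (insert 0 (length ` set L))"
    using assms by unfold_locales auto
  note lt = is_partition_of_lam_tilde[OF assms]
  \<comment> \<open>The cardinality becomes two witnesses, as in \<open>multiple_below_top\<close>;
    the bound \<open>j < r\<close> is implicit because \<open>shape L\<close> vanishes beyond the
    last component.\<close>
  have ge2: "2 \<le> card {j. j < r \<and> 1 \<le> part (L ! j) (Suc a) - part (L ! j) (Suc a + 1)} \<longleftrightarrow>
      (\<exists>j j'. j \<noteq> j' \<and> shape L (j, Suc a) < shape L (j, a) \<and> shape L (j', Suc a) < shape L (j', a))"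
    for a
  proof -
    have "{j. j < r \<and> 1 \<le> part (L ! j) (Suc a) - part (L ! j) (Suc a + 1)} =
        {j. shape L (j, Suc a) < shape L (j, a)}" (is "_ = ?S")
      using length_L by (auto simp: shape_def)
    moreover have "finite ?S"
      by (rule finite_subset[of _ "{..<r}"]) (auto simp: shape_def length_L split: if_splits)
    moreover have "2 \<le> card ?S \<longleftrightarrow> \<not> card ?S \<le> Suc 0" by linarith
    ultimately show ?thesis
      using card_le_Suc0_iff_eq[of ?S] by (simp only:) blast
  qed
  show ?thesis
  proof
    assume U: "?U = {?lt}"
    show "\<forall>i\<ge>1. ?cond i"
    proof (intro allI impI, rule ccontr)
      fix i :: nat assume "1 \<le> i" and no: "\<not> ?cond i"
      then obtain a where a: "i = Suc a" by (cases i) auto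
      let ?t = "\<lambda>t. part ?lt (Suc t)"
      have drop2: "?t (Suc a) + 2 \<le> ?t a" using no a by auto
      then obtain j where j: "shape L (j, Suc a) < shape L (j, a)"
        using component_drop[of a] by (auto simp: col_eq)
      have uniq: "k = j" if "shape L (k, Suc a) < shape L (k, a)" for k
        using no ge2[of a] j that a by auto
      \<comment> \<open>One unit moves from row \<open>a\<close> to row \<open>Suc a\<close>, so
        only the partial sum at \<open>Suc a\<close> falls, by one. A drop of at least 2 keeps the
        sequence weakly decreasing.\<close>
      define f where "f t = (if t = a then ?t t - 1 else if t = Suc a then ?t t + 1 else ?t t)" for t
      \<comment> \<open>Beyond both altered rows and all parts of \<open>lam_tilde L\<close>, so
        that \<open>f M = 0\<close> and the sum up to \<open>M\<close> is unaffected by the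
        move.\<close>
      define M where "M = a + 2 + length ?lt"
      have sums: "(\<Sum>t<m. f t) = top_sum m - (if m = Suc a then 1 else 0)" for m
      proof -
        have "(\<Sum>t<m. f t) + (if m = Suc a then 1 else 0) = (\<Sum>t<m. ?t t)"
          using drop2 by (induction m) (auto simp: f_def)
        then show ?thesis unfolding top_sum_eq partial_sums_def by linarith
      qed
      have "f (Suc t) \<le> f t" for t
        using part_Suc_Suc_le[OF lt, of t] drop2 by (auto simp: f_def)
      moreover have "f M = 0" by (simp add: f_def M_def part_def)
      ultimately obtain mu where mu: "is_partition_of (\<Sum>t<M. f t) mu" "\<And>t. part mu (Suc t) = f t"
        by (rule partition_exists) auto
      have "top_sum M = n"
        unfolding top_sum_eq using lt by (rule partial_sums_stable) (simp add: M_def)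
      then have mun: "is_partition_of n mu"
        using mu(1) unfolding sums[of M] by (simp add: M_def)
      have psum: "partial_sums mu = (\<lambda>t. top_sum t - (if t = Suc a then 1 else 0))"
        unfolding partial_sums_def mu(2) sums ..
      have "multikostka L mu = 1"
        unfolding multikostka_eq[OF mun] psum by (rule card_patterns_one_cut[OF j uniq])
      then have "mu = ?lt" using mun U by blast
      then show False using mu(2)[of a] drop2 by (simp add: f_def)
    qed
  next
    assume cond: "\<forall>i\<ge>1. ?cond i"
    have "multikostka L ?lt = 1"
      unfolding multikostka_eq[OF lt] top_sum_eq[symmetric] patterns_top_sum by simp
    moreover have "mu = ?lt" if mu: "is_partition_of n mu" and one: "multikostka L mu = 1" for mu
    proof (rule ccontr)
      assume "mu \<noteq> ?lt"
      then have ne: "partial_sums mu \<noteq> top_sum"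
        using partial_sums_inj[OF mu lt] top_sum_eq by metis
      obtain P where P: "patterns (partial_sums mu) = {P}"
        using one unfolding multikostka_eq[OF mu] by (rule card_1_singletonE)
      have zero: "partial_sums mu 0 = 0" by (simp add: partial_sums_def)
      have stable: "top_sum m = partial_sums mu m" if "m \<ge> length ?lt + length mu" for m
        using that partial_sums_stable[OF mu, of m] partial_sums_stable[OF lt, of m]
        by (simp add: top_sum_eq)
      have le: "partial_sums mu m \<le> top_sum m" for m
        using P zero by (intro pattern_sum_le[of P]) auto
      have drops: "col a - col (Suc a) \<le> 1 \<or> (\<exists>j j'. j \<noteq> j' \<and>
          shape L (j, Suc a) < shape L (j, a) \<and> shape L (j', Suc a) < shape L (j', a))" for a
        using cond[rule_format, of "Suc a"] ge2[of a] by (simp add: col_eq)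
      have "multiple (partial_sums mu)"
        by (rule multiple_below_top[OF le zero stable partial_sums_concave[OF mu] ne drops])
      then show False using P by (auto simp: multiple_def)
    qed
    ultimately show "?U = {?lt}" using lt by blast
  qed
qed

end
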